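(* Let $k,t$ be integers with $t\ge 1$ and $k\ge t+1$, and let $i\ge 0$. There is a bijection between the set of partial $(k-t-1,t)$-Motzkin paths of length $i$ with an elevation line and the set of free $(k-t-1,t)$-Motzkin paths of length $i$.
   Context: All paths start at $(0,0)$ and use steps $U=(1,1)$, $D=(1,-1)$, $H=(1,0)$; the length is the number of steps. A partial Motzkin path is such a path that never goes below the $x$-axis (with no restriction on its endpoint); it ends at level $\ell$ if its endpoint has $y$-coordinate $\ell$. A free Motzkin path is such a path with no restriction at all (it may go below the $x$-axis). In a partial, respectively free, $(a,b)$-Motzkin path, each up step carries weight $1$, each horizontal step carries weight $a$ and each down step carries weight $b$ (the weights are attached to the steps; they do not create multiple copies of a path, so the underlying sets are sets of ordinary lattice paths). A partial Motzkin path with an elevation line is a pair $(P,p)$ where $P$ is a partial Motzkin path ending at some level $\ell$ and $p$ is an integer with $0\le p\le \ell$ (the line $y=p$ is the elevation line). *)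

theory Defs
  imports Main "HOL-Library.Product_Plus"
begin

datatype step = Up | Down | Horiz

fun step_vec :: "step \<Rightarrow> int \<times> int" where
  "step_vec Up = (1, 1)"
| "step_vec Down = (1, -1)"
| "step_vec Horiz = (1, 0)"

fun step_weight :: "int \<Rightarrow> int \<Rightarrow> step \<Rightarrow> int" where
  "step_weight a b Up = 1"
| "step_weight a b Down = b"
| "step_weight a b Horiz = a"

text \<open>A path is a list of steps, each carrying its weight as a label. In an \<open>(a,b)\<close>-path the
  label is determined by the step, so each underlying lattice path occurs exactly once, also
  when a weight is \<open>0\<close> or larger than \<open>1\<close>.\<close>

type_synonym weighted_path = "(step \<times> int) list"

definition has_weights :: "int \<Rightarrow> int \<Rightarrow> weighted_path \<Rightarrow> bool" where
  "has_weights a b w \<longleftrightarrow> (\<forall>(s, c) \<in> set w. c = step_weight a b s)"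

definition endpoint :: "weighted_path \<Rightarrow> int \<times> int" where
  "endpoint w = (0, 0) + sum_list (map (step_vec \<circ> fst) w)"

definition end_level :: "weighted_path \<Rightarrow> int" where
  "end_level w = snd (endpoint w)"

definition never_below_axis :: "weighted_path \<Rightarrow> bool" where
  "never_below_axis w \<longleftrightarrow> (\<forall>n \<le> length w. 0 \<le> snd (endpoint (take n w)))"

definition free_motzkin_paths :: "int \<Rightarrow> int \<Rightarrow> nat \<Rightarrow> weighted_path set" where
  "free_motzkin_paths a b i = {w. length w = i \<and> has_weights a b w}"

definition partial_motzkin_paths :: "int \<Rightarrow> int \<Rightarrow> nat \<Rightarrow> weighted_path set" where
  "partial_motzkin_paths a b i =
     {w. length w = i \<and> has_weights a b w \<and> never_below_axis w}"

definition elevated_partial_motzkin_paths ::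
    "int \<Rightarrow> int \<Rightarrow> nat \<Rightarrow> (weighted_path \<times> int) set" where
  "elevated_partial_motzkin_paths a b i =
     {(w, p). w \<in> partial_motzkin_paths a b i \<and> 0 \<le> p \<and> p \<le> end_level w}"

end

theory Submission imports Defs begin

text \<open>Append the steps one at a time. If \<open>P\<close> ends at level \<open>\<ell>\<close>, then \<open>P U\<close> admits one elevation line
  more than \<open>P\<close>, namely \<open>y = \<ell> + 1\<close>, and \<open>P D\<close> one less, namely \<open>y = \<ell>\<close>; this also holds for
  \<open>\<ell> = 0\<close>, where \<open>P D\<close> is not a partial path and \<open>y = 0\<close> is the only line of \<open>P\<close>. Sending the forbidden
  combination of a line at the end level and a down step to \<open>(P U, \<ell> + 1)\<close> therefore makes an
  elevated path of length \<open>i + 1\<close> the same as an elevated path of length \<open>i\<close> together with an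
  arbitrary step, and free paths grow in the same way.\<close>

fun append_step :: "int \<Rightarrow> int \<Rightarrow> weighted_path \<times> step \<Rightarrow> weighted_path" where
  "append_step a b (w, s) = w @ [(s, step_weight a b s)]"

fun append_step_elevated ::
    "int \<Rightarrow> int \<Rightarrow> (weighted_path \<times> int) \<times> step \<Rightarrow> weighted_path \<times> int" where
  "append_step_elevated a b ((w, p), s) =
     (if s = Down \<and> p = end_level w then (append_step a b (w, Up), p + 1)
      else (append_step a b (w, s), p))"

lemma end_level_Nil [simp]: "end_level [] = 0"
  by (simp add: end_level_def endpoint_def zero_prod_def)

lemma end_level_snoc [simp]: "end_level (w @ [x]) = end_level w + snd (step_vec (fst x))"
  by (simp add: end_level_def endpoint_def)

lemma has_weights_snoc [simp]:
  "has_weights a b (w @ [(s, c)]) \<longleftrightarrow> has_weights a b w \<and> c = step_weight a b s"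
  by (auto simp: has_weights_def)

lemma never_below_axis_snoc [simp]:
  "never_below_axis (w @ [x]) \<longleftrightarrow> never_below_axis w \<and> 0 \<le> end_level (w @ [x])"
  by (auto simp: never_below_axis_def end_level_def le_Suc_eq simp del: end_level_snoc)

lemma end_level_nonneg: "never_below_axis w \<Longrightarrow> 0 \<le> end_level w"
  by (auto simp: never_below_axis_def end_level_def)

lemma bij_betw_append_step:
  "bij_betw (append_step a b) (free_motzkin_paths a b i \<times> UNIV) (free_motzkin_paths a b (Suc i))"
proof (rule bij_betw_imageI)
  show "inj_on (append_step a b) (free_motzkin_paths a b i \<times> UNIV)"
    by (auto simp: inj_on_def)
  show "append_step a b ` (free_motzkin_paths a b i \<times> UNIV) = free_motzkin_paths a b (Suc i)"
    by (auto simp: free_motzkin_paths_def length_Suc_conv_rev intro!: rev_image_eqI)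
qed

lemma bij_betw_append_step_elevated:
  "bij_betw (append_step_elevated a b) (elevated_partial_motzkin_paths a b i \<times> UNIV)
     (elevated_partial_motzkin_paths a b (Suc i))"
    (is "bij_betw ?g (?E i \<times> UNIV) _")
proof (rule bij_betw_imageI)
  \<comment> \<open>A redirected pair ends in \<open>Up\<close> with its line at the new end level;
    an ordinary \<open>Up\<close> keeps \<open>p\<close> \<le> \<open>end_level w\<close>, strictly
    below that level.\<close>
  show "inj_on ?g (?E i \<times> UNIV)"
    by (auto simp: inj_on_def elevated_partial_motzkin_paths_def split: if_splits)
  show "?g ` (?E i \<times> UNIV) = ?E (Suc i)"
  proof (intro subset_antisym subsetI)
    fix y assume "y \<in> ?g ` (?E i \<times> UNIV)"
    then obtain w p s where "(w, p) \<in> ?E i" and "y = ?g ((w, p), s)"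
      by auto
    \<comment> \<open>An appended \<open>Down\<close> has 0 \<le> \<open>p\<close> <
      \<open>end_level w\<close>, so the path stays weakly above the axis and \<open>p\<close>
      remains a line of it.\<close>
    then show "y \<in> ?E (Suc i)"
      by (cases s) (auto simp: elevated_partial_motzkin_paths_def partial_motzkin_paths_def)
  next
    fix y assume y: "y \<in> ?E (Suc i)"
    then obtain w s p where y_eq: "y = (append_step a b (w, s), p)"
      by (auto simp: elevated_partial_motzkin_paths_def partial_motzkin_paths_def
          length_Suc_conv_rev)
    \<comment> \<open>After a final \<open>Up\<close>, the line at height
      \<open>end_level w + 1\<close> exceeds every line of \<open>w\<close>, so only a redirected
      \<open>Down\<close> can produce it.\<close>
    let ?x = "if s = Up \<and> p = end_level w + 1 then ((w, p - 1), Down) else ((w, p), s)"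
    have "?x \<in> ?E i \<times> UNIV"
      using y unfolding y_eq
      by (cases s) (auto simp: elevated_partial_motzkin_paths_def partial_motzkin_paths_def
          intro: end_level_nonneg)
    moreover have "y = ?g ?x"
      using y unfolding y_eq
      by (cases s) (auto simp: elevated_partial_motzkin_paths_def)
    ultimately show "y \<in> ?g ` (?E i \<times> UNIV)"
      by (rule rev_image_eqI)
  qed
qed

lemma elevated_paths_bij_free_paths:
  "\<exists>f. bij_betw f (elevated_partial_motzkin_paths a b i) (free_motzkin_paths a b i)"
proof (induction i)
  case 0
  have "elevated_partial_motzkin_paths a b 0 = {([], 0)}" "free_motzkin_paths a b 0 = {[]}"
    by (auto simp: elevated_partial_motzkin_paths_def partial_motzkin_paths_def
        free_motzkin_paths_def has_weights_def never_below_axis_def endpoint_def)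
  then show ?case
    by (auto simp: bij_betw_def)
next
  case (Suc i)
  then obtain f where
    "bij_betw f (elevated_partial_motzkin_paths a b i) (free_motzkin_paths a b i)"
    by blast
  then have "bij_betw (map_prod f id) (elevated_partial_motzkin_paths a b i \<times> (UNIV :: step set))
      (free_motzkin_paths a b i \<times> UNIV)"
    by (simp add: bij_betw_map_prod)
  \<comment> \<open>Split off a step with the inverse of \<open>append_step_elevated\<close>, apply
    \<open>f\<close> to the shorter elevated path, and append that step to the result.\<close>
  then show ?case
    using bij_betw_trans[OF bij_betw_trans[OF
        bij_betw_inv_into[OF bij_betw_append_step_elevated]] bij_betw_append_step]
    by blast
qed

theorem theorem4p4:
  fixes k t :: int and i :: nat
  assumes "t \<ge> 1" and "k \<ge> t + 1"
  shows "\<exists>f. bij_betw f (elevated_partial_motzkin_paths (k - t - 1) t i)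
                        (free_motzkin_paths (k - t - 1) t i)"
  by (rule elevated_paths_bij_free_paths)

end
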